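(* Let $(C, I, O)$ be an ILP Modulo $T$ instance and consider the $\mathrm{BC}(T)$ transition system for it. If $\langle \{\langle C, \emptyset\rangle\}, \mathrm{none}\rangle \longrightarrow^* \langle \emptyset, \mathrm{none}\rangle$, then $C \wedge I$ is $T$-unsatisfiable, i.e. there is no integer assignment that is a $T$-model of $C \wedge I$.
   Context: Fix a set $\mathcal V$ of integer variables. An integer linear constraint has the form $c_1v_1+\dots+c_nv_n \bowtie r$ with integers $c_i, r$, $v_i \in \mathcal V$, $\bowtie \in \{<,\le,=,>,\ge\}$; an integer linear formula is a finite set (conjunction) of such constraints. An integer assignment is a function $A:\mathcal V\to\mathbb Z$, identified with the set of formulas $\{v = A(v) : v\in\mathcal V\}$. $\mathcal Z$ denotes the theory of linear integer arithmetic (all first-order sentences over the signature $0,\pm1,\pm2,\dots,+,-,\le$ true in the standard model $\mathbb Z$). For a theory $T'$, a formula $F$ is $T'$-consistent if $F\wedge T'$ has a model, and $F\models_{T'} G$ means $F\wedge\neg G$ is $T'$-inconsistent. Let $T$ be a $\Sigma$-theory with $\Sigma$ disjoint from the signature of $\mathcal Z$. A $\Sigma$-interface atom is a $\Sigma$-atomic formula $t$, possibly annotated with a variable $v$ (written $t^v$), the annotation meaning $t \Leftrightarrow v>0$. An ILP Modulo $T$ instance is a triple $(C, I, O)$ with $C$ an integer linear formula, $I$ a set of $\Sigma$-interface atoms, and $O=\sum_i c_i v_i$ an integer linear expression to be minimized. For an assignment $A$, $obj(A)=\sum_i c_iA(v_i)$; also $obj(\mathrm{none})=+\infty$ and $obj(A^{-\infty})=-\infty$.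 An assignment $A$ is a $T$-model of a formula $F$ if $A$ is $T$-consistent and $A\models_{\mathcal Z\cup T} F$. A simple equality is a constraint $v_i=c$ or $v_i-v_j=c$ ($c$ an integer constant). A subproblem is a pair $\langle C, D\rangle$ with $C$ a set of integer linear constraints and $D$ a set of simple equalities. A state is a pair $\langle P, A\rangle$ where $P$ is a set of subproblems and $A$ is either the constant $\mathrm{none}$, an assignment, or an assignment annotated with superscript $-\infty$. A fixed function $lb$ on subproblems satisfies: no assignment $A$ satisfying $C\wedge D$ has $obj(A) < lb(\langle C,D\rangle)$. Notation: $P\uplus Q$ is union of disjoint sets; $C\,c$ is $C\cup\{c\}$ with $c\notin C$ (likewise $D\,d$). The transition relation $\longrightarrow$ of $\mathrm{BC}(T)$ is given by the rules: Branch: $\langle P\uplus\{\langle C,D\rangle\}, A\rangle \longrightarrow \langle P\cup\{\langle C_i,D\rangle : 1\le i\le n\}, A\rangle$ if $n>1$, $D\models_{\mathcal Z}(C\Leftrightarrow\bigvee_{i} C_i)$, and the $C_i$ are syntactically distinct. Learn: $\langle P\uplus\{\langle C,D\rangle\},A\rangle\longrightarrow\langle P\cup\{\langle C\,c,D\rangle\},A\rangle$ if $C\wedge D\models_{\mathcal Z} c$. Forget: $\langle P\uplus\{\langle C\,c,D\rangle\},A\rangle\longrightarrow\langle P\cup\{\langle C,D\rangle\},A\rangle$ if $C\wedge D\models_{\mathcal Z} c$. Propagate: $\langle P\uplus\{\langle C,D\rangle\},A\rangle\longrightarrow\langle P\cup\{\langle C,D\,d\rangle\},A\rangle$ if $d$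 is a simple equality and $C\wedge D\models_{\mathcal Z} d$. Drop: $\langle P\uplus\{\langle C,D\rangle\},A\rangle\longrightarrow\langle P,A\rangle$ if $C\wedge D$ has no integer solution. Prune: $\langle P\uplus\{\langle C,D\rangle\},A\rangle\longrightarrow\langle P,A\rangle$ if $A\neq\mathrm{none}$ and $lb(\langle C,D\rangle)\ge obj(A)$. Retire: $\langle P\uplus\{\langle C,D\rangle\},A\rangle\longrightarrow\langle P,A'\rangle$ if $A'$ is a $T$-model of $C\wedge D\wedge I$, $obj(A')<obj(A)$, and $obj(A')\le obj(B)$ for every $T$-model $B$ of $C\wedge D\wedge I$. Unbounded: $\langle P\uplus\{\langle C,D\rangle\},A\rangle\longrightarrow\langle \emptyset,A'^{-\infty}\rangle$ if $A'$ is a $T$-model of $C\wedge D\wedge I$, $obj(A')\le obj(A)$, and for every $k$ there is a $T$-model $B$ of $C\wedge D\wedge I$ with $obj(B)<k$. T-Learn: $\langle P\uplus\{\langle C,D\rangle\},A\rangle\longrightarrow\langle P\cup\{\langle C\,c,D\rangle\},A\rangle$ if there is a formula $F$ with $C\wedge D\models_{\mathcal Z} F$ and $F\wedge I\models_T c$. $S\longrightarrow^* S'$ means $S=S'$ or there is a finite nonempty chain of $\longrightarrow$ transitions from $S$ to $S'$.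
   Formalization: It is additionally assumed that if T has a model then Z ∪ T has one; otherwise the claim fails: for T = {∀x y. x = y}, every assignment is vacuously a T-model of C = {0 < 0}, yet Drop leads to ⟨∅, none⟩. *)

theory Defs
  imports Complex_Main "HOL-Library.Extended_Real"
begin

section \<open>First-order logic with equality\<close>

datatype ('f, vars_trm: 'x) trm = Var 'x | App 'f "('f, 'x) trm list"

datatype ('f, 'p, 'x) fm =
    Eq "('f, 'x) trm" "('f, 'x) trm"
  | Rel 'p "('f, 'x) trm list"
  | Neg "('f, 'p, 'x) fm"
  | And "('f, 'p, 'x) fm" "('f, 'p, 'x) fm"
  | All 'x "('f, 'p, 'x) fm"

definition Imp :: "('f, 'p, 'x) fm \<Rightarrow> ('f, 'p, 'x) fm \<Rightarrow> ('f, 'p, 'x) fm" where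
  "Imp \<phi> \<psi> = Neg (And \<phi> (Neg \<psi>))"

definition Iff :: "('f, 'p, 'x) fm \<Rightarrow> ('f, 'p, 'x) fm \<Rightarrow> ('f, 'p, 'x) fm" where
  "Iff \<phi> \<psi> = And (Imp \<phi> \<psi>) (Imp \<psi> \<phi>)"

primrec fv :: "('f, 'p, 'x) fm \<Rightarrow> 'x set" where
  "fv (Eq t u) = vars_trm t \<union> vars_trm u"
| "fv (Rel p ts) = \<Union> (vars_trm ` set ts)"
| "fv (Neg \<phi>) = fv \<phi>"
| "fv (And \<phi> \<psi>) = fv \<phi> \<union> fv \<psi>"
| "fv (All x \<phi>) = fv \<phi> - {x}"

text \<open>A signature lists its symbols with their arities; constants are function symbols of
  arity 0.\<close>

record ('f, 'p) signature =
  funs :: "('f \<times> nat) set"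
  preds :: "('p \<times> nat) set"

definition disjoint_signatures :: "('f, 'p) signature \<Rightarrow> ('f, 'p) signature \<Rightarrow> bool" where
  "disjoint_signatures S S' \<longleftrightarrow>
     fst ` funs S \<inter> fst ` funs S' = {} \<and> fst ` preds S \<inter> fst ` preds S' = {}"

primrec sig_trm :: "('f, 'p) signature \<Rightarrow> ('f, 'x) trm \<Rightarrow> bool" where
  "sig_trm S (Var x) = True"
| "sig_trm S (App f ts) = ((f, length ts) \<in> funs S \<and> list_all (sig_trm S) ts)"

primrec sig_fm :: "('f, 'p) signature \<Rightarrow> ('f, 'p, 'x) fm \<Rightarrow> bool" where
  "sig_fm S (Eq t u) = (sig_trm S t \<and> sig_trm S u)"
| "sig_fm S (Rel p ts) = ((p, length ts) \<in> preds S \<and> list_all (sig_trm S) ts)"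
| "sig_fm S (Neg \<phi>) = sig_fm S \<phi>"
| "sig_fm S (And \<phi> \<psi>) = (sig_fm S \<phi> \<and> sig_fm S \<psi>)"
| "sig_fm S (All x \<phi>) = sig_fm S \<phi>"

primrec atomic :: "('f, 'p, 'x) fm \<Rightarrow> bool" where
  "atomic (Eq t u) = True"
| "atomic (Rel p ts) = True"
| "atomic (Neg \<phi>) = False"
| "atomic (And \<phi> \<psi>) = False"
| "atomic (All x \<phi>) = False"

definition sentences :: "('f, 'p) signature \<Rightarrow> ('f, 'p, 'x) fm set" where
  "sentences S = {\<phi>. sig_fm S \<phi> \<and> fv \<phi> = {}}"

record ('f, 'p, 'u) struct =
  univ :: "'u set"
  fint :: "'f \<Rightarrow> 'u list \<Rightarrow> 'u"
  pint :: "'p \<Rightarrow> 'u list \<Rightarrow> bool"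

definition wf_struct :: "('f, 'p, 'u) struct \<Rightarrow> bool" where
  "wf_struct M \<longleftrightarrow> univ M \<noteq> {} \<and> (\<forall>f us. set us \<subseteq> univ M \<longrightarrow> fint M f us \<in> univ M)"

primrec val :: "('f, 'p, 'u) struct \<Rightarrow> ('x \<Rightarrow> 'u) \<Rightarrow> ('f, 'x) trm \<Rightarrow> 'u" where
  "val M s (Var x) = s x"
| "val M s (App f ts) = fint M f (map (val M s) ts)"

primrec sat :: "('f, 'p, 'u) struct \<Rightarrow> ('x \<Rightarrow> 'u) \<Rightarrow> ('f, 'p, 'x) fm \<Rightarrow> bool" where
  "sat M s (Eq t u) = (val M s t = val M s u)"
| "sat M s (Rel p ts) = pint M p (map (val M s) ts)"
| "sat M s (Neg \<phi>) = (\<not> sat M s \<phi>)"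
| "sat M s (And \<phi> \<psi>) = (sat M s \<phi> \<and> sat M s \<psi>)"
| "sat M s (All x \<phi>) = (\<forall>u \<in> univ M. sat M (s(x := u)) \<phi>)"

section \<open>Consistency and entailment modulo a theory\<close>

text \<open>HOL cannot quantify over the type of the elements of a model, so models are taken
  over nonempty subsets of one fixed type, that of the formulas themselves. Its cardinality is
  the maximum of \<open>\<aleph>\<^sub>0\<close> and the numbers of symbols and variables, so by the downward
  Loewenheim-Skolem theorem a set of formulas has such a model iff it has a model at all.\<close>

type_synonym ('f, 'p, 'x) interp =
  "('f, 'p, ('f, 'p, 'x) fm) struct \<times> ('x \<Rightarrow> ('f, 'p, 'x) fm)"

definition interps :: "('f, 'p, 'x) interp set" where
  "interps = {(M, s). wf_struct M \<and> range s \<subseteq> univ M}"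

text \<open>A set of formulas is read as its (possibly infinite) conjunction.\<close>

definition holds :: "('f, 'p, 'x) fm set \<Rightarrow> ('f, 'p, 'x) interp \<Rightarrow> bool" where
  "holds \<Gamma> = (\<lambda>(M, s). \<forall>\<phi>\<in>\<Gamma>. sat M s \<phi>)"

text \<open>In the next two definitions \<open>F\<close> and \<open>G\<close> are truth conditions, usually of the form
  \<^term>\<open>holds \<Gamma>\<close>. This also allows propositional combinations of infinite conjunctions.\<close>

definition consistent ::
  "('f, 'p, 'x) fm set \<Rightarrow> (('f, 'p, 'x) interp \<Rightarrow> bool) \<Rightarrow> bool" where
  "consistent T F \<longleftrightarrow> (\<exists>m\<in>interps. holds T m \<and> F m)"

definition entails ::
  "('f, 'p, 'x) fm set \<Rightarrow> (('f, 'p, 'x) interp \<Rightarrow> bool) \<Rightarrow>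
   (('f, 'p, 'x) interp \<Rightarrow> bool) \<Rightarrow> bool" where
  "entails T F G \<longleftrightarrow> \<not> consistent T (\<lambda>m. F m \<and> \<not> G m)"

section \<open>Linear integer arithmetic\<close>

text \<open>\<open>Fn\<close> and \<open>Pr\<close> supply the symbols from which signatures disjoint from that of linear
  integer arithmetic are built.\<close>

datatype 'f fsym = Num int | Plus | Minus | Fn 'f
datatype 'p psym = LeZ | Pr 'p

text \<open>The integer variables are the elements of the type \<open>'v\<close>. The other variables are
  available for bound variables and for use in theory atoms.\<close>

datatype 'v var = IVar 'v | OVar nat

type_synonym ('f, 'v) lia_trm = "('f fsym, 'v var) trm"
type_synonym ('f, 'p, 'v) lia_fm = "('f fsym, 'p psym, 'v var) fm"

definition sig_Z :: "('f fsym, 'p psym) signature" where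
  "sig_Z = \<lparr>funs = insert (Plus, 2) (insert (Minus, 2) (range (\<lambda>k. (Num k, 0)))),
            preds = {(LeZ, 2)}\<rparr>"

fun std_fint :: "'f fsym \<Rightarrow> int list \<Rightarrow> int" where
  "std_fint (Num k) [] = k"
| "std_fint Plus [a, b] = a + b"
| "std_fint Minus [a, b] = a - b"
| "std_fint _ _ = 0"

fun std_pint :: "'p psym \<Rightarrow> int list \<Rightarrow> bool" where
  "std_pint LeZ [a, b] = (a \<le> b)"
| "std_pint _ _ = False"

definition std_Z :: "('f fsym, 'p psym, int) struct" where
  "std_Z = \<lparr>univ = UNIV, fint = std_fint, pint = std_pint\<rparr>"

definition theory_Z :: "('f, 'p, 'v) lia_fm set" where
  "theory_Z = {\<phi> \<in> sentences sig_Z. \<forall>s. sat std_Z s \<phi>}"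

abbreviation num :: "int \<Rightarrow> ('f, 'v) lia_trm" where
  "num k \<equiv> App (Num k) []"

abbreviation leZ :: "('f, 'v) lia_trm \<Rightarrow> ('f, 'v) lia_trm \<Rightarrow> ('f, 'p, 'v) lia_fm" where
  "leZ t u \<equiv> Rel LeZ [t, u]"

subsection \<open>Linear constraints\<close>

text \<open>The list \<open>[(c\<^sub>1, v\<^sub>1), \<dots>, (c\<^sub>n, v\<^sub>n)]\<close> stands for \<open>c\<^sub>1 v\<^sub>1 + \<dots> + c\<^sub>n v\<^sub>n\<close>.\<close>

type_synonym 'v lin_expr = "(int \<times> 'v) list"

datatype comparison = LT | LE | EQ | GE | GT

datatype 'v constraint = Constraint "'v lin_expr" comparison int

definition lin_value :: "('v \<Rightarrow> int) \<Rightarrow> 'v lin_expr \<Rightarrow> int" where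
  "lin_value A e = (\<Sum>(c, v)\<leftarrow>e. c * A v)"

fun compare :: "comparison \<Rightarrow> int \<Rightarrow> int \<Rightarrow> bool" where
  "compare LT a b = (a < b)"
| "compare LE a b = (a \<le> b)"
| "compare EQ a b = (a = b)"
| "compare GE a b = (a \<ge> b)"
| "compare GT a b = (a > b)"

fun satisfies :: "('v \<Rightarrow> int) \<Rightarrow> 'v constraint \<Rightarrow> bool" where
  "satisfies A (Constraint e r k) = compare r (lin_value A e) k"

text \<open>The signature has no multiplication, so \<open>c v\<close> is written as an iterated sum.\<close>

primrec scale :: "nat \<Rightarrow> ('f, 'v) lia_trm \<Rightarrow> ('f, 'v) lia_trm" where
  "scale 0 t = num 0"
| "scale (Suc n) t = App Plus [scale n t, t]"

definition monomial :: "int \<Rightarrow> 'v \<Rightarrow> ('f, 'v) lia_trm" where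
  "monomial c v =
     (if c \<ge> 0 then scale (nat c) (Var (IVar v))
      else App Minus [num 0, scale (nat (- c)) (Var (IVar v))])"

fun lin_trm :: "'v lin_expr \<Rightarrow> ('f, 'v) lia_trm" where
  "lin_trm [] = num 0"
| "lin_trm ((c, v) # e) = App Plus [monomial c v, lin_trm e]"

fun compare_fm ::
  "comparison \<Rightarrow> ('f, 'v) lia_trm \<Rightarrow> ('f, 'v) lia_trm \<Rightarrow> ('f, 'p, 'v) lia_fm" where
  "compare_fm LT t u = Neg (leZ u t)"
| "compare_fm LE t u = leZ t u"
| "compare_fm EQ t u = Eq t u"
| "compare_fm GE t u = leZ u t"
| "compare_fm GT t u = Neg (leZ t u)"

fun constraint_fm :: "'v constraint \<Rightarrow> ('f, 'p, 'v) lia_fm" where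
  "constraint_fm (Constraint e r k) = compare_fm r (lin_trm e) (num k)"

definition simple_equalities :: "'v constraint set" where
  "simple_equalities =
     {Constraint [(1, v)] EQ k |v k. True} \<union> {Constraint [(1, v), (-1, w)] EQ k |v w k. True}"

section \<open>ILP modulo theories\<close>

text \<open>An interface atom \<open>(t, Some v)\<close> is the atom \<open>t\<close> annotated with \<open>v\<close>.\<close>

type_synonym ('f, 'p, 'v) iatom = "('f, 'p, 'v) lia_fm \<times> 'v option"

definition interface_atoms ::
  "('f fsym, 'p psym) signature \<Rightarrow> ('f, 'p, 'v) iatom set" where
  "interface_atoms S = {(t, a). sig_fm S t \<and> atomic t}"

fun iatom_fm :: "('f, 'p, 'v) iatom \<Rightarrow> ('f, 'p, 'v) lia_fm" where
  "iatom_fm (t, None) = t"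
| "iatom_fm (t, Some v) = Iff t (Neg (leZ (Var (IVar v)) (num 0)))"

definition assignment_fms :: "('v \<Rightarrow> int) \<Rightarrow> ('f, 'p, 'v) lia_fm set" where
  "assignment_fms A = range (\<lambda>v. Eq (Var (IVar v)) (num (A v)))"

definition T_model ::
  "('f, 'p, 'v) lia_fm set \<Rightarrow> ('v \<Rightarrow> int) \<Rightarrow> ('f, 'p, 'v) lia_fm set \<Rightarrow> bool" where
  "T_model T A F \<longleftrightarrow>
     consistent T (holds (assignment_fms A)) \<and>
     entails (theory_Z \<union> T) (holds (assignment_fms A)) (holds F)"

text \<open>The arithmetic theory and a theory over a disjoint signature are jointly consistent iff the
  latter has an infinite model; in particular the condition below holds for every stably
  infinite \<open>T\<close>. If it fails (\<open>T\<close> is consistent but has only finite models), then entailment modulo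
  \<^term>\<open>theory_Z \<union> T\<close> is vacuous and every assignment is a \<open>T\<close>-model of every formula, even of
  a set of constraints without integer solutions.\<close>

definition Z_compatible :: "('f, 'p, 'v) lia_fm set \<Rightarrow> bool" where
  "Z_compatible T \<longleftrightarrow>
     (consistent T (holds {}) \<longrightarrow> consistent (theory_Z \<union> T) (holds {}))"

type_synonym 'v subproblem = "'v constraint set \<times> 'v constraint set"

text \<open>The second component of a state: none, an assignment \<open>A\<close>, or an annotated assignment
  \<open>A\<close> with superscript minus infinity.\<close>

datatype 'v incumbent = NoAsg | Asg "'v \<Rightarrow> int" | AsgMinf "'v \<Rightarrow> int"

type_synonym 'v state = "'v subproblem set \<times> 'v incumbent"

fun obj :: "'v lin_expr \<Rightarrow> 'v incumbent \<Rightarrow> ereal" where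
  "obj Ob NoAsg = \<infinity>"
| "obj Ob (Asg A) = ereal (of_int (lin_value A Ob))"
| "obj Ob (AsgMinf A) = -\<infinity>"

definition lower_bound :: "'v lin_expr \<Rightarrow> ('v subproblem \<Rightarrow> ereal) \<Rightarrow> bool" where
  "lower_bound Ob lb \<longleftrightarrow>
     (\<forall>C D. D \<subseteq> simple_equalities \<longrightarrow>
        \<not> (\<exists>A. (\<forall>c \<in> C \<union> D. satisfies A c) \<and> obj Ob (Asg A) < lb (C, D)))"

abbreviation holds_cs :: "'v constraint set \<Rightarrow> ('f fsym, 'p psym, 'v var) interp \<Rightarrow> bool" where
  "holds_cs C \<equiv> holds (constraint_fm ` C)"

definition node_fms ::
  "('f, 'p, 'v) iatom set \<Rightarrow> 'v constraint set \<Rightarrow> 'v constraint set \<Rightarrow> ('f, 'p, 'v) lia_fm set" where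
  "node_fms I C D = constraint_fm ` C \<union> constraint_fm ` D \<union> iatom_fm ` I"

inductive bc_step ::
  "('f, 'p, 'v) lia_fm set \<Rightarrow> ('f, 'p, 'v) iatom set \<Rightarrow> 'v lin_expr \<Rightarrow>
   ('v subproblem \<Rightarrow> ereal) \<Rightarrow> 'v state \<Rightarrow> 'v state \<Rightarrow> bool"
  for T I Ob lb where
  Branch:
    "\<lbrakk>(C, D) \<notin> P; length Cs > 1; distinct Cs;
      entails (theory_Z :: ('f, 'p, 'v) lia_fm set) (holds_cs D)
        (\<lambda>m. holds_cs C m \<longleftrightarrow> (\<exists>C' \<in> set Cs. holds_cs C' m))\<rbrakk>
     \<Longrightarrow> bc_step T I Ob lb (P \<union> {(C, D)}, A) (P \<union> {(C', D) |C'. C' \<in> set Cs}, A)"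
| Learn:
    "\<lbrakk>(C, D) \<notin> P; c \<notin> C;
      entails (theory_Z :: ('f, 'p, 'v) lia_fm set) (holds_cs (C \<union> D)) (holds_cs {c})\<rbrakk>
     \<Longrightarrow> bc_step T I Ob lb (P \<union> {(C, D)}, A) (P \<union> {(C \<union> {c}, D)}, A)"
| Forget:
    "\<lbrakk>(C \<union> {c}, D) \<notin> P; c \<notin> C;
      entails (theory_Z :: ('f, 'p, 'v) lia_fm set) (holds_cs (C \<union> D)) (holds_cs {c})\<rbrakk>
     \<Longrightarrow> bc_step T I Ob lb (P \<union> {(C \<union> {c}, D)}, A) (P \<union> {(C, D)}, A)"
| Propagate:
    "\<lbrakk>(C, D) \<notin> P; d \<in> simple_equalities; d \<notin> D;
      entails (theory_Z :: ('f, 'p, 'v) lia_fm set) (holds_cs (C \<union> D)) (holds_cs {d})\<rbrakk>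
     \<Longrightarrow> bc_step T I Ob lb (P \<union> {(C, D)}, A) (P \<union> {(C, D \<union> {d})}, A)"
| Drop:
    "\<lbrakk>(C, D) \<notin> P; \<not> (\<exists>B. \<forall>c \<in> C \<union> D. satisfies B c)\<rbrakk>
     \<Longrightarrow> bc_step T I Ob lb (P \<union> {(C, D)}, A) (P, A)"
| Prune:
    "\<lbrakk>(C, D) \<notin> P; A \<noteq> NoAsg; lb (C, D) \<ge> obj Ob A\<rbrakk>
     \<Longrightarrow> bc_step T I Ob lb (P \<union> {(C, D)}, A) (P, A)"
| Retire:
    "\<lbrakk>(C, D) \<notin> P; T_model T A' (node_fms I C D); obj Ob (Asg A') < obj Ob A;
      \<forall>B. T_model T B (node_fms I C D) \<longrightarrow> obj Ob (Asg A') \<le> obj Ob (Asg B)\<rbrakk>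
     \<Longrightarrow> bc_step T I Ob lb (P \<union> {(C, D)}, A) (P, Asg A')"
| Unbounded:
    "\<lbrakk>(C, D) \<notin> P; T_model T A' (node_fms I C D); obj Ob (Asg A') \<le> obj Ob A;
      \<forall>k::int. \<exists>B. T_model T B (node_fms I C D) \<and> lin_value B Ob < k\<rbrakk>
     \<Longrightarrow> bc_step T I Ob lb (P \<union> {(C, D)}, A) ({}, AsgMinf A')"
| T_Learn:
    "\<lbrakk>(C, D) \<notin> P; c \<notin> C;
      entails theory_Z (holds_cs (C \<union> D)) (holds {F});
      entails T (holds ({F} \<union> iatom_fm ` I)) (holds_cs {c})\<rbrakk>
     \<Longrightarrow> bc_step T I Ob lb (P \<union> {(C, D)}, A) (P \<union> {(C \<union> {c}, D)}, A)"

end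

(* In a model of integer arithmetic that satisfies the equalities of an assignment A, a linear
   constraint holds iff A satisfies it; hence the constraints do not distinguish between such
   models, and a branch chosen in one of them is correct in all. Compatibility of T with
   arithmetic guarantees that at least one such model exists, which rules out vacuous T-models.
   No transition leads back to the incumbent "none", so only Branch, Learn, Forget, Propagate,
   Drop and T-Learn occur in the run, and each of them passes a T-model of some subproblem on to
   a subproblem of the successor state. *)

theory Submission
  imports Defs
begin

section \<open>Satisfaction and free variables\<close>

lemma val_cong:
  assumes "\<And>x. x \<in> vars_trm t \<Longrightarrow> s x = s' x"
  shows "val M s t = val M s' t"
  using assms
proof (induction t)
  case (App f ts)
  then have "map (val M s) ts = map (val M s') ts"
    by auto
  then show ?case
    by (simp del: map_eq_conv)
qed simp

lemma sat_cong:
  assumes "\<And>x. x \<in> fv \<phi> \<Longrightarrow> s x = s' x"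
  shows "sat M s \<phi> \<longleftrightarrow> sat M s' \<phi>"
  using assms
proof (induction \<phi> arbitrary: s s')
  case (Eq t u)
  then show ?case
    using val_cong[of t s s' M] val_cong[of u s s' M] by simp
next
  case (Rel p ts)
  then have "map (val M s) ts = map (val M s') ts"
    by (auto intro!: val_cong)
  then show ?case
    by (simp del: map_eq_conv)
next
  case (Neg \<phi>)
  then show ?case
    by (metis fv.simps(3) sat.simps(3))
next
  case (And \<phi> \<psi>)
  then show ?case
    by (metis Un_iff fv.simps(4) sat.simps(4))
next
  case (All x \<phi>)
  have "sat M (s(x := u)) \<phi> \<longleftrightarrow> sat M (s'(x := u)) \<phi>" for u
    by (rule All.IH) (use All.prems in auto)
  then show ?case
    by simp
qed

text \<open>Since \<open>interps\<close> pairs structures with valuations, this allows the valuation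
  to be changed without leaving the models of a theory.\<close>

lemma holds_sentences_cong:
  assumes "\<And>\<phi>. \<phi> \<in> \<Gamma> \<Longrightarrow> fv \<phi> = {}"
  shows "holds \<Gamma> (M, s) \<longleftrightarrow> holds \<Gamma> (M, s')"
proof -
  have "sat M s \<phi> \<longleftrightarrow> sat M s' \<phi>" if "\<phi> \<in> \<Gamma>" for \<phi>
    by (rule sat_cong) (use assms that in auto)
  then show ?thesis
    by (auto simp: holds_def)
qed

lemma holds_Un: "holds (\<Gamma> \<union> \<Delta>) m \<longleftrightarrow> holds \<Gamma> m \<and> holds \<Delta> m"
  by (auto simp: holds_def split: prod.splits)

lemma entails_iff: "entails T F G \<longleftrightarrow> (\<forall>m\<in>interps. holds T m \<longrightarrow> F m \<longrightarrow> G m)"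
  by (auto simp: entails_def consistent_def)

section \<open>Linear constraints in models of integer arithmetic\<close>

context
  fixes M :: "('f fsym, 'p psym, ('f, 'p, 'v) lia_fm) struct"
    and s :: "'v var \<Rightarrow> ('f, 'p, 'v) lia_fm"
  assumes Z: "holds (theory_Z :: ('f, 'p, 'v) lia_fm set) (M, s)"
begin

text \<open>\<open>M\<close> may be nonstandard, but it agrees with the integers on sentences. The
  ground facts about numerals below are obtained this way, the negative ones from negated sentences
  in \<open>theory_Z\<close>.\<close>

lemma sat_theory_Z:
  fixes \<phi> :: "('f, 'p, 'v) lia_fm"
  assumes "sig_fm sig_Z \<phi>" "fv \<phi> = {}" "\<And>r. sat std_Z r \<phi>"
  shows "sat M s \<phi>"
  using Z assms by (auto simp: holds_def theory_Z_def sentences_def)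

lemma fint_Plus: "fint M Plus [fint M (Num a) [], fint M (Num b) []] = fint M (Num (a + b)) []"
  using sat_theory_Z[of "Eq (App Plus [num a, num b]) (num (a + b))"]
  by (simp add: sig_Z_def std_Z_def)

lemma fint_Minus: "fint M Minus [fint M (Num a) [], fint M (Num b) []] = fint M (Num (a - b)) []"
  using sat_theory_Z[of "Eq (App Minus [num a, num b]) (num (a - b))"]
  by (simp add: sig_Z_def std_Z_def)

lemma fint_Num_eq_iff: "fint M (Num a) [] = fint M (Num b) [] \<longleftrightarrow> a = b"
  using sat_theory_Z[of "Neg (Eq (num a) (num b))"]
  by (cases "a = b") (simp_all add: sig_Z_def std_Z_def)

lemma pint_LeZ: "pint M LeZ [fint M (Num a) [], fint M (Num b) []] \<longleftrightarrow> a \<le> b"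
  using sat_theory_Z[of "leZ (num a) (num b)"] sat_theory_Z[of "Neg (leZ (num a) (num b))"]
  by (cases "a \<le> b") (simp_all add: sig_Z_def std_Z_def)

context
  fixes A :: "'v \<Rightarrow> int"
  assumes A: "holds (assignment_fms A) (M, s)"
begin

lemma val_IVar: "s (IVar v) = fint M (Num (A v)) []"
  using A by (auto simp: holds_def assignment_fms_def)

lemma val_scale: "val M s (scale n (Var (IVar v))) = fint M (Num (int n * A v)) []"
  by (induction n) (simp_all add: val_IVar fint_Plus algebra_simps)

lemma val_monomial: "val M s (monomial c v) = fint M (Num (c * A v)) []"
  by (simp add: monomial_def val_scale fint_Minus)

text \<open>The equalities of \<open>A\<close> make every integer variable denote a numeral, so
  evaluation stays among the numerals of \<open>M\<close>, where arithmetic is standard.\<close>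

lemma val_lin_trm: "val M s (lin_trm e) = fint M (Num (lin_value A e)) []"
  by (induction e rule: lin_trm.induct) (simp_all add: lin_value_def val_monomial fint_Plus)

lemma sat_constraint_fm: "sat M s (constraint_fm c) \<longleftrightarrow> satisfies A c"
proof (cases c)
  case (Constraint e r k)
  then show ?thesis
    by (cases r) (auto simp: val_lin_trm fint_Num_eq_iff pint_LeZ)
qed

lemma holds_constraint_fms: "holds (constraint_fm ` C) (M, s) \<longleftrightarrow> (\<forall>c\<in>C. satisfies A c)"
  by (auto simp: holds_def sat_constraint_fm)

end

end

lemma holds_cs_iff_satisfies:
  fixes m :: "('f fsym, 'p psym, 'v var) interp"
  assumes "holds theory_Z m" "holds (assignment_fms A) m"
  shows "holds_cs C m \<longleftrightarrow> (\<forall>c\<in>C. satisfies A c)"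
  using assms by (cases m) (simp add: holds_constraint_fms)

section \<open>Soundness of the transitions\<close>

text \<open>Sentences ignore the valuation, so in any joint model of the two theories the integer
  variables can be revalued at will.\<close>

lemma consistent_assignment:
  fixes T :: "('f, 'p, 'v) lia_fm set"
  assumes "\<And>\<phi>. \<phi> \<in> T \<Longrightarrow> fv \<phi> = {}" and "consistent (theory_Z \<union> T) (holds {})"
  shows "consistent (theory_Z \<union> T) (holds (assignment_fms A))"
proof -
  from assms(2) obtain M s where Ms: "(M, s) \<in> interps" "holds (theory_Z \<union> T) (M, s)"
    by (auto simp: consistent_def)
  \<comment> \<open>The new values lie in the universe because \<open>wf_struct\<close> closes it
    under \<open>fint\<close>.\<close>
  define s' where "s' = (\<lambda>x. case x of IVar v \<Rightarrow> fint M (Num (A v)) [] | OVar n \<Rightarrow> s (OVar n))"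
  have "(M, s') \<in> interps"
    using Ms(1) by (auto simp: interps_def wf_struct_def s'_def split: var.splits)
  moreover have "fv \<phi> = {}" if "\<phi> \<in> theory_Z \<union> T" for \<phi>
    using that assms(1) by (auto simp: theory_Z_def sentences_def)
  then have "holds (theory_Z \<union> T) (M, s')"
    using Ms(2) holds_sentences_cong by metis
  moreover have "holds (assignment_fms A) (M, s')"
    by (auto simp: holds_def assignment_fms_def s'_def)
  ultimately show ?thesis
    by (auto simp: consistent_def)
qed

text \<open>\<open>T_model\<close> demands consistency of \<open>A\<close> with \<open>T\<close>
  alone. This makes \<open>T\<close> consistent, \<open>Z_compatible\<close> then yields a joint
  model, and its valuation is adjusted to \<open>A\<close>.\<close>

lemma T_model_imp_consistent:
  fixes T :: "('f, 'p, 'v) lia_fm set"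
  assumes "\<And>\<phi>. \<phi> \<in> T \<Longrightarrow> fv \<phi> = {}" and "Z_compatible T" and "T_model T A F"
  shows "consistent (theory_Z \<union> T) (holds (assignment_fms A))"
proof (rule consistent_assignment)
  show "consistent (theory_Z \<union> T) (holds {})"
    using assms(2,3) by (auto simp: Z_compatible_def T_model_def consistent_def holds_def)
qed (use assms(1) in auto)

text \<open>The consistency half of \<open>T_model\<close> does not mention the formula, so only the
  entailment half has to be transferred, model by model.\<close>

lemma T_model_mono:
  fixes T :: "('f, 'p, 'v) lia_fm set"
  assumes "T_model T A F"
    and "\<And>m. m \<in> interps \<Longrightarrow> holds theory_Z m \<Longrightarrow> holds T m \<Longrightarrow> holds (assignment_fms A) m \<Longrightarrow>
           holds F m \<Longrightarrow> holds G m"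
  shows "T_model T A G"
  using assms by (auto simp: T_model_def entails_iff holds_Un)

lemma holds_node_fms:
  "holds (node_fms I C D) m \<longleftrightarrow> holds_cs C m \<and> holds_cs D m \<and> holds (iatom_fm ` I) m"
  by (auto simp: node_fms_def holds_Un)

text \<open>The entailment is evaluated in an actual joint model, where \<open>A\<close> alone
  decides the truth of constraints.\<close>

lemma T_model_node_satisfies:
  fixes T :: "('f, 'p, 'v) lia_fm set"
  assumes "\<And>\<phi>. \<phi> \<in> T \<Longrightarrow> fv \<phi> = {}" and "Z_compatible T" and "T_model T A (node_fms I C D)"
  shows "\<forall>c\<in>C \<union> D. satisfies A c"
proof -
  obtain m where m: "m \<in> interps" "holds (theory_Z \<union> T) m" "holds (assignment_fms A) m"
    using T_model_imp_consistent[OF assms] by (auto simp: consistent_def)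
  with assms(3) have "holds (node_fms I C D) m"
    by (auto simp: T_model_def entails_iff)
  with m show ?thesis
    by (auto simp: holds_node_fms holds_Un holds_cs_iff_satisfies)
qed

lemma T_model_branch:
  fixes T :: "('f, 'p, 'v) lia_fm set"
  assumes "\<And>\<phi>. \<phi> \<in> T \<Longrightarrow> fv \<phi> = {}" and "Z_compatible T" and model: "T_model T A (node_fms I C D)"
    and split: "entails (theory_Z :: ('f, 'p, 'v) lia_fm set) (holds_cs D)
                  (\<lambda>m. holds_cs C m \<longleftrightarrow> (\<exists>C' \<in> \<C>. holds_cs C' m))"
  shows "\<exists>C' \<in> \<C>. T_model T A (node_fms I C' D)"
proof -
  obtain m where m: "m \<in> interps" "holds (theory_Z \<union> T) m" "holds (assignment_fms A) m"
    using T_model_imp_consistent[OF assms(1,2) model] by (auto simp: consistent_def)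
  with model have "holds (node_fms I C D) m"
    by (auto simp: T_model_def entails_iff)
  with m(1,2) split obtain C' where C': "C' \<in> \<C>" "holds_cs C' m"
    by (auto simp: entails_iff holds_node_fms holds_Un)
  \<comment> \<open>This no longer mentions \<open>m\<close>, so the branch \<open>C'\<close> chosen
    in \<open>m\<close> holds in every joint model of the theories and the equalities of
    \<open>A\<close>.\<close>
  with m(2,3) have "\<forall>c\<in>C'. satisfies A c"
    by (simp add: holds_Un holds_cs_iff_satisfies)
  then have "T_model T A (node_fms I C' D)"
    by (intro T_model_mono[OF model]) (simp add: holds_node_fms holds_cs_iff_satisfies)
  with C'(1) show ?thesis
    by blast
qed

text \<open>Every rule either keeps the incumbent or installs \<open>Asg\<close> or
  \<open>AsgMinf\<close>.\<close>

lemma bc_step_from_NoAsg: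
  assumes "bc_step T I Ob lb (P, A) (P', NoAsg)"
  shows "A = NoAsg"
  using assms by cases auto

lemma bc_step_preserves_T_model:
  fixes T :: "('f, 'p, 'v) lia_fm set"
  assumes closed: "\<And>\<phi>. \<phi> \<in> T \<Longrightarrow> fv \<phi> = {}" and compat: "Z_compatible T"
    and step: "bc_step T I Ob lb (P, NoAsg) (P', NoAsg)"
    and model: "(C, D) \<in> P" "T_model T A (node_fms I C D)"
  shows "\<exists>(C', D') \<in> P'. T_model T A (node_fms I C' D')"
  using step
proof cases
  case (Branch C0 D0 Q Cs)
  show ?thesis
  proof (cases "(C, D) \<in> Q")
    case False
    with Branch model have "\<exists>C' \<in> set Cs. T_model T A (node_fms I C' D)"
      by (intro T_model_branch[OF closed compat]) auto
    with False Branch model(1) show ?thesis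
      by auto
  qed (use Branch model in auto)
next
  case (Learn C0 D0 Q c)
  have "T_model T A (node_fms I (C0 \<union> {c}) D0)" if "(C, D) = (C0, D0)"
    using model(2)
    by (rule T_model_mono)
      (use Learn that in \<open>unfold entails_iff holds_node_fms image_Un holds_Un, blast\<close>)
  with Learn model show ?thesis
    by fastforce
next
  case (Forget C0 c D0 Q)
  have "T_model T A (node_fms I C0 D0)" if "(C, D) = (C0 \<union> {c}, D0)"
    using model(2)
    by (rule T_model_mono) (use that in \<open>auto simp: node_fms_def holds_def\<close>)
  with Forget model show ?thesis
    by fastforce
next
  case (Propagate C0 D0 Q d)
  have "T_model T A (node_fms I C0 (D0 \<union> {d}))" if "(C, D) = (C0, D0)"
    using model(2)
    by (rule T_model_mono)
      (use Propagate that in \<open>unfold entails_iff holds_node_fms image_Un holds_Un, blast\<close>)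
  with Propagate model show ?thesis
    by fastforce
next
  case (Drop C0 D0)
  \<comment> \<open>The dropped subproblem has no integer solution, whereas \<open>A\<close> solves
    \<open>(C, D)\<close>; hence \<open>(C, D)\<close> is another one and survives.\<close>
  with T_model_node_satisfies[OF closed compat model(2)] model show ?thesis
    by auto
next
  case (T_Learn C0 D0 Q c F)
  have "T_model T A (node_fms I (C0 \<union> {c}) D0)" if "(C, D) = (C0, D0)"
    using model(2)
  proof (rule T_model_mono)
    fix m :: "('f fsym, 'p psym, 'v var) interp"
    assume m: "m \<in> interps" "holds theory_Z m" "holds T m" "holds (node_fms I C D) m"
    \<comment> \<open>As \<open>m\<close> models both theories, the two entailments of the rule
      compose: arithmetic gives \<open>F\<close>, then \<open>T\<close> with the interface atoms
      gives \<open>c\<close>.\<close>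
    with T_Learn that have "holds {F} m"
      by (auto simp: holds_node_fms entails_iff holds_Un image_Un)
    with m T_Learn have "holds_cs {c} m"
      unfolding entails_iff holds_node_fms holds_Un by blast
    with m that show "holds (node_fms I (C0 \<union> {c}) D0) m"
      unfolding holds_node_fms image_Un holds_Un by auto
  qed
  with T_Learn model show ?thesis
    by fastforce
\<comment> \<open>Left are \<open>Prune\<close>, which starts from an incumbent other than
  \<open>NoAsg\<close>, and \<open>Retire\<close> and \<open>Unbounded\<close>, which end in
  one.\<close>
qed auto

lemma bc_steps_preserve_T_model:
  fixes T :: "('f, 'p, 'v) lia_fm set"
  assumes "\<And>\<phi>. \<phi> \<in> T \<Longrightarrow> fv \<phi> = {}" and "Z_compatible T"
    and "(bc_step T I Ob lb)\<^sup>*\<^sup>* S (P', NoAsg)"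
    and "\<exists>(C, D) \<in> fst S. T_model T A (node_fms I C D)"
  shows "\<exists>(C, D) \<in> P'. T_model T A (node_fms I C D)"
  using assms(3,4)
proof (induction "(P', NoAsg :: 'v incumbent)" arbitrary: P' rule: rtranclp_induct)
  case base
  then show ?case
    by simp
next
  case (step S')
  obtain Q B where S': "S' = (Q, B)"
    by fastforce
  \<comment> \<open>The induction extends the run at its end, so \<open>NoAsg\<close> must be traced
    back one transition before the induction hypothesis applies.\<close>
  with step.hyps(2) have "B = NoAsg"
    using bc_step_from_NoAsg by blast
  with step S' obtain C D where "(C, D) \<in> Q" "T_model T A (node_fms I C D)"
    by blast
  with step.hyps(2) S' \<open>B = NoAsg\<close> show ?case
    using bc_step_preserves_T_model[OF assms(1,2)] by blast
qed

theorem theorem1: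
  fixes Sig :: "('f fsym, 'p psym) signature"
    and T :: "('f, 'p, 'v) lia_fm set"
    and C :: "'v constraint set"
    and I :: "('f, 'p, 'v) iatom set"
    and Ob :: "'v lin_expr"
    and lb :: "'v subproblem \<Rightarrow> ereal"
  assumes "disjoint_signatures Sig sig_Z"
    and "T \<subseteq> sentences Sig"
    and "Z_compatible T"
    and "finite C"
    and "I \<subseteq> interface_atoms Sig"
    and "lower_bound Ob lb"
    and "(bc_step T I Ob lb)\<^sup>*\<^sup>* ({(C, {})}, NoAsg) ({}, NoAsg)"
  shows "\<not> (\<exists>A. T_model T A (constraint_fm ` C \<union> iatom_fm ` I))"
proof
  assume "\<exists>A. T_model T A (constraint_fm ` C \<union> iatom_fm ` I)"
  then obtain A where "T_model T A (node_fms I C {})"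
    by (auto simp: node_fms_def)
  moreover have "fv \<phi> = {}" if "\<phi> \<in> T" for \<phi>
    using that assms(2) by (auto simp: sentences_def)
  \<comment> \<open>The final state has no subproblem left to carry the model.\<close>
  ultimately have "\<exists>(C', D') \<in> {}. T_model T A (node_fms I C' D')"
    using bc_steps_preserve_T_model[OF _ assms(3,7)] by fastforce
  then show False
    by simp
qed

end
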